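(* Let $T\subset\mathbb{R}^n$ be closed, let $I\subset\mathbb{Z}_+^n$ be finite with $0\in I$, and let $g=(g_i)_{i\in I}$ be a family of real numbers with $g_0=1$. Set $m=\max_{i\in I}|i|$ and $N=\operatorname{card} I$. Let $a,\rho$ be measurable functions on $T$ with $0<a<\infty$ and $0<\rho<\infty$ a.e., such that $$\int_T e^{\frac{\|t\|^m+1}{\alpha\,a(t)}}\rho(t)\,dt<\infty\quad\text{for all }\alpha>0,$$ and such that $a$ is independent of $(t^i)_{i\in I\setminus\{0\}}$. Suppose also that $a(t)=\sum_{i\in I}c_it^i$ for some real constants $(c_i)_{i\in I}$ with $\sum_{i\in I}c_ig_i>0$. Let $$L(\lambda)=\sum_{i\in I}g_i\lambda_i-\int_T e^{\sum_{i\in I}\lambda_i t^i/a(t)\,-1}\,\rho(t)\,dt\qquad(\lambda=(\lambda_i)_{i\in I}\in\mathbb{R}^N).$$ If $\sup_{\mathbb{R}^N}L<\infty$, then there is a $\lambda^*\in\mathbb{R}^N$ at which the supremum is attained: $\sup L=L(\lambda^* )$.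
   Context: $\mathbb{Z}_+=\{0,1,2,\dots\}$; $dt$ is Lebesgue measure on $\mathbb{R}^n$; for $i=(i_1,\dots,i_n)\in\mathbb{Z}_+^n$, $t^i=t_1^{i_1}\cdots t_n^{i_n}$ and $|i|=i_1+\cdots+i_n$. $\|\cdot\|$ is a norm on $\mathbb{R}^n$ (the choice is unimportant; e.g. the Euclidean norm). A function $a$ on $T$ is called independent of $(t^i)_{i\in I\setminus\{0\}}$ if there are no measurable subset $Z\subset T$ of positive Lebesgue measure and constants $(d_i)_{i\in I\setminus\{0\}}$ such that $a(t)=\sum_{i\in I\setminus\{0\}}d_it^i$ on $Z$. *)

theory Defs
  imports "HOL-Analysis.Analysis"
begin

(* Multi-indices are vectors nat ^ 'n, so that 0 is the zero multi-index and the
   dimension is shared with real ^ 'n. *)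

definition monomial :: "nat ^ 'n \<Rightarrow> real ^ 'n \<Rightarrow> real" where
  "monomial i t = (\<Prod>k\<in>UNIV. (t $ k) ^ (i $ k))"

definition mdegree :: "nat ^ 'n \<Rightarrow> nat" where
  "mdegree i = (\<Sum>k\<in>UNIV. i $ k)"

(* The norm of the type class is the Euclidean one; this predicate allows any norm. *)
definition is_norm :: "(real ^ 'n \<Rightarrow> real) \<Rightarrow> bool" where
  "is_norm \<nu> \<longleftrightarrow>
     (\<forall>x. 0 \<le> \<nu> x) \<and>
     (\<forall>x. \<nu> x = 0 \<longleftrightarrow> x = 0) \<and>
     (\<forall>r x. \<nu> (r *\<^sub>R x) = \<bar>r\<bar> * \<nu> x) \<and>
     (\<forall>x y. \<nu> (x + y) \<le> \<nu> x + \<nu> y)"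

(* a is independent of the monomials with exponents in J. *)
definition independent_of_monomials ::
  "(real ^ 'n) set \<Rightarrow> (nat ^ 'n) set \<Rightarrow> (real ^ 'n \<Rightarrow> ereal) \<Rightarrow> bool" where
  "independent_of_monomials T J a \<longleftrightarrow>
     \<not> (\<exists>Z (d :: nat ^ 'n \<Rightarrow> real).
           Z \<subseteq> T \<and> Z \<in> sets lebesgue \<and> emeasure lebesgue Z > 0 \<and>
           (\<forall>t\<in>Z. a t = ereal (\<Sum>i\<in>J. d i * monomial i t)))"

(* a and \<rho> are extended real-valued and only a.e. finite and positive, so real_of_ereal
   changes them on a null set at most. The Bochner integral is 0 for a non-integrable
   integrand; under the integrability hypothesis of the theorem this does not occur,
   as \<bar>\<Sum>i\<in>I. l i * monomial i t\<bar> is bounded by a multiple of \<nu> t ^ m + 1. *)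
definition dual_functional ::
  "(real ^ 'n) set \<Rightarrow> (nat ^ 'n) set \<Rightarrow> (nat ^ 'n \<Rightarrow> real) \<Rightarrow>
   (real ^ 'n \<Rightarrow> ereal) \<Rightarrow> (real ^ 'n \<Rightarrow> ereal) \<Rightarrow> (nat ^ 'n \<Rightarrow> real) \<Rightarrow> real" where
  "dual_functional T I g a \<rho> l =
     (\<Sum>i\<in>I. g i * l i) -
     (LINT t|lebesgue_on T.
        exp ((\<Sum>i\<in>I. l i * monomial i t) / real_of_ereal (a t) - 1) * real_of_ereal (\<rho> t))"

end

theory Submission
  imports Defs
begin

text \<open>
  Write \<open>\<phi>\<^sub>i = t\<^sup>i / a\<close>, so that the dual functional is \<open>L(\<lambda>) = g \<cdot> \<lambda> - A(\<lambda>)\<close>, where the mass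
  \<open>A(\<lambda>)\<close> is the integral of \<open>exp (\<Sum>\<^sub>i \<lambda>\<^sub>i \<phi>\<^sub>i - 1) \<rho>\<close>. A maximising sequence has a limit point at
  which the supremum is attained, because Fatou's lemma makes \<open>A\<close> lower semicontinuous, provided
  that the sequence is bounded. The point is therefore that superlevel sets of \<open>L\<close> are bounded
  (\<open>superlevel_bounded\<close>).

  Suppose \<open>L(\<mu>\<^sub>n) \<ge> B\<close> with \<open>r\<^sub>n = |\<mu>\<^sub>n| \<rightarrow> \<infinity>\<close>, and let \<open>e\<close> be a limit of \<open>\<mu>\<^sub>n / r\<^sub>n\<close>. The linear
  part of \<open>L\<close> grows at most like \<open>r\<^sub>n\<close>, hence so does \<open>A(\<mu>\<^sub>n)\<close>; as the integrand would be exponentially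
  large in \<open>r\<^sub>n\<close> wherever \<open>E = \<Sum>\<^sub>i e\<^sub>i \<phi>\<^sub>i\<close> is positive, \<open>E \<le> 0\<close> almost everywhere. A nonzero polynomial
  vanishes only on a null set, so in fact \<open>E < 0\<close> almost everywhere. Moreover \<open>g \<cdot> e \<ge> 0\<close>, since \<open>A \<ge> 0\<close>
  gives \<open>g \<cdot> \<mu>\<^sub>n \<ge> B\<close>. Moving from the origin along \<open>e\<close> thus sends the mass to zero at no linear cost.
  The representation \<open>a = \<Sum>\<^sub>i c\<^sub>i t\<^sup>i\<close> says \<open>\<Sum>\<^sub>i c\<^sub>i \<phi>\<^sub>i = 1\<close>, so a shift by \<open>u c\<close> multiplies the mass
  by the constant \<open>exp u\<close> and adds \<open>u (g \<cdot> c)\<close> to the linear part. As \<open>g \<cdot> c > 0\<close>, choosing first \<open>u\<close> large and then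
  going far along \<open>e\<close> makes \<open>L\<close> arbitrarily large, against \<open>sup L < \<infinity>\<close>.

  The argument makes sense for arbitrary functions \<open>\<phi>\<^sub>i\<close> on a measure space whose nontrivial
  combinations vanish only on null sets and for which \<open>A\<close> is finite; it is carried out there. For
  monomials, finiteness of \<open>A\<close> follows from the integrability hypothesis, because a linear
  combination of monomials of degree at
  most \<open>m\<close> is bounded by a multiple of \<open>\<parallel>t\<parallel>\<^sup>m + 1\<close>.
\<close>

section \<open>Zero sets of polynomials\<close>

text \<open>
  Exponents are functions on the index set, and the injectivity assumption says that distinct
  members of \<open>J\<close> give distinct monomials in the variables of \<open>K\<close>. In the induction a new variable \<open>k\<close>
  is integrated first: for almost all values of the old variables, the coefficient of
  \<open>x\<^sub>k\<close> to the power \<open>i0 k\<close> is nonzero, so the polynomial in \<open>x\<^sub>k\<close> has only finitely many roots.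
\<close>

lemma AE_PiM_polynomial_nonzero:
  fixes K :: "'k set" and J :: "('k \<Rightarrow> nat) set" and d :: "('k \<Rightarrow> nat) \<Rightarrow> real"
  assumes "finite K" "finite J" "inj_on (\<lambda>i. restrict i K) J" "i0 \<in> J" "d i0 \<noteq> 0"
  shows "AE x in PiM K (\<lambda>_. lborel :: real measure). (\<Sum>i\<in>J. d i * (\<Prod>k\<in>K. x k ^ i k)) \<noteq> 0"
  using assms
proof (induction K arbitrary: J i0 rule: finite_induct)
  case empty
  have "J = {i0}"
    using empty.prems by (auto simp: inj_on_def)
  then show ?case
    using empty.prems by simp
next
  case (insert k K)
  interpret product_sigma_finite "\<lambda>_::'k. lborel :: real measure" ..
  let ?p = "\<lambda>x :: 'k \<Rightarrow> real. \<Sum>i\<in>J. d i * (\<Prod>k\<in>insert k K. x k ^ i k)"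
  \<comment> \<open>The exponents that contribute to the coefficient of \<open>x k ^ i0 k\<close>.\<close>
  define J' where "J' = {i\<in>J. i k = i0 k}"
  have inj': "inj_on (\<lambda>i. restrict i K) J'"
  proof (rule inj_onI)
    fix i j assume ij: "i \<in> J'" "j \<in> J'" "restrict i K = restrict j K"
    have "restrict i (insert k K) = restrict j (insert k K)"
    proof
      fix l show "restrict i (insert k K) l = restrict j (insert k K) l"
        using ij(1,2) fun_cong[OF ij(3), of l] by (auto simp: J'_def restrict_def split: if_splits)
    qed
    then show "i = j"
      using insert.prems(2) ij(1,2) unfolding inj_on_def J'_def by blast
  qed
  have IH: "AE x in PiM K (\<lambda>_. lborel). (\<Sum>i\<in>J'. d i * (\<Prod>k\<in>K. x k ^ i k)) \<noteq> 0"
    using insert.prems by (intro insert.IH[OF _ inj', of i0]) (auto simp: J'_def)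
  have fin: "finite {y. ?p (x(k := y)) = 0}"
    if x: "(\<Sum>i\<in>J'. d i * (\<Prod>k\<in>K. x k ^ i k)) \<noteq> 0" for x :: "'k \<Rightarrow> real"
  proof -
    define P where "P = (\<Sum>i\<in>J. monom (d i * (\<Prod>k\<in>K. x k ^ i k)) (i k))"
    have prodK: "(\<Prod>l\<in>K. (x(k := y)) l ^ i l) = (\<Prod>l\<in>K. x l ^ i l)" for y i
      using insert.hyps by (intro prod.cong) auto
    have "?p (x(k := y)) = poly P y" for y
      using insert.hyps prodK
      by (simp add: P_def poly_sum poly_monom mult_ac)
    moreover have "coeff P (i0 k) = (\<Sum>i\<in>J'. d i * (\<Prod>k\<in>K. x k ^ i k))"
      using insert.prems by (simp add: P_def coeff_sum J'_def sum.inter_filter)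
    then have "P \<noteq> 0"
      using x by auto
    ultimately show ?thesis
      using poly_roots_finite[of P] by simp
  qed
  have meas [measurable]: "?p \<in> borel_measurable (PiM (insert k K) (\<lambda>_. lborel))"
    by measurable
  let ?z = "\<lambda>x. if ?p x = 0 then 1 else 0 :: ennreal"
  have "(\<integral>\<^sup>+x. ?z x \<partial>PiM (insert k K) (\<lambda>_. lborel))
      = (\<integral>\<^sup>+x. \<integral>\<^sup>+y. ?z (x(k := y)) \<partial>lborel \<partial>PiM K (\<lambda>_. lborel))"
    using insert.hyps by (intro product_nn_integral_insert) measurable
  also have "\<dots> = (\<integral>\<^sup>+x. 0 \<partial>PiM K (\<lambda>_. lborel :: real measure))"
  proof (rule nn_integral_cong_AE, use IH in eventually_elim)
    case (elim x)
    have "(\<integral>\<^sup>+y. ?z (x(k := y)) \<partial>lborel)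
        = (\<integral>\<^sup>+y. indicator {y. ?p (x(k := y)) = 0} y \<partial>lborel)"
      by (intro nn_integral_cong) (simp add: indicator_def)
    also have "\<dots> = emeasure lborel {y. ?p (x(k := y)) = 0}"
      using finite_imp_closed[OF fin[OF elim]] by (intro nn_integral_indicator) (simp add: borel_closed)
    also have "\<dots> = 0"
      using fin[OF elim] by (intro emeasure_lborel_countable countable_finite)
    finally show ?case .
  qed
  finally have zero: "(\<integral>\<^sup>+x. ?z x \<partial>PiM (insert k K) (\<lambda>_. lborel)) = 0"
    by simp
  have "AE x in PiM (insert k K) (\<lambda>_. lborel). ?z x = 0"
    by (subst nn_integral_0_iff_AE[symmetric]) (measurable, fact zero)
  then show ?case
    by eventually_elim (simp split: if_splits)
qed

text \<open>
  Lebesgue measure on \<open>real ^ 'n\<close> is the image of a product measure indexed by the basis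
  vectors, so exponents have to be transported from the index type \<open>'n\<close> to the basis.
\<close>

lemma AE_lebesgue_monomial_sum_nonzero:
  fixes I :: "(nat ^ 'n) set" and e :: "nat ^ 'n \<Rightarrow> real"
  assumes "finite I" "i0 \<in> I" "e i0 \<noteq> 0"
  shows "AE t in lebesgue. (\<Sum>i\<in>I. e i * monomial i t) \<noteq> 0"
proof -
  let ?B = "Basis :: (real ^ 'n) set"
  define ex :: "nat ^ 'n \<Rightarrow> real ^ 'n \<Rightarrow> nat" where "ex i b = i $ (THE k. b = axis k 1)" for i b
  have ex_axis [simp]: "ex i (axis k 1) = i $ k" for i k
    unfolding ex_def by (rule arg_cong[of _ _ "($) i"]) (auto simp: axis_eq_axis)
  have B: "?B = (\<lambda>k. axis k 1) ` UNIV"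
    by (auto simp: Basis_vec_def)
  have inj_axis: "inj (\<lambda>k :: 'n. axis k (1 :: real))"
    by (auto simp: inj_on_def axis_eq_axis)
  have inj: "inj ex"
    by (rule injI) (metis ex_axis vec_eq_iff)
  have mono: "monomial i (\<Sum>b\<in>?B. f b *\<^sub>R b) = (\<Prod>b\<in>?B. f b ^ ex i b)" for i f
  proof -
    have "(\<Sum>b\<in>?B. f b *\<^sub>R b) $ k = f (axis k 1)" for k
    proof -
      have "(\<Sum>b\<in>?B. f b *\<^sub>R b) $ k = (\<Sum>b\<in>?B. f b *\<^sub>R b) \<bullet> axis k 1"
        by (simp add: inner_axis)
      also have "\<dots> = f (axis k 1)"
        by (rule inner_sum_left_Basis) simp
      finally show ?thesis .
    qed
    then show ?thesis
      using inj_axis by (simp add: monomial_def B prod.reindex)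
  qed
  have "AE f in PiM ?B (\<lambda>_. lborel). (\<Sum>j\<in>ex ` I. e (inv ex j) * (\<Prod>b\<in>?B. f b ^ j b)) \<noteq> 0"
  proof (rule AE_PiM_polynomial_nonzero)
    show "inj_on (\<lambda>i. restrict i ?B) (ex ` I)"
    proof (rule inj_onI, clarify)
      fix i j assume eq: "restrict (ex i) ?B = restrict (ex j) ?B"
      have "i $ k = j $ k" for k
        using fun_cong[OF eq, of "axis k 1"] by simp
      then have "i = j"
        by (simp add: vec_eq_iff)
      then show "ex i = ex j"
        by simp
    qed
  qed (use assms inj in auto)
  then have "AE f in PiM ?B (\<lambda>_. lborel). (\<Sum>i\<in>I. e i * (\<Prod>b\<in>?B. f b ^ ex i b)) \<noteq> 0"
    using inj by (simp add: sum.reindex inj_on_subset[OF inj])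
  then have "AE f in PiM ?B (\<lambda>_. lborel).
      (\<Sum>i\<in>I. e i * monomial i (\<Sum>b\<in>?B. f b *\<^sub>R b)) \<noteq> 0"
    by (simp add: mono)
  then have "AE t in lborel. (\<Sum>i\<in>I. e i * monomial i t) \<noteq> 0"
    by (subst lborel_eq, subst AE_distr_iff) (auto simp: monomial_def)
  then show ?thesis
    by (rule AE_completion)
qed

section \<open>Bounding monomials by a norm\<close>

text \<open>
  Any norm is Lipschitz for the Euclidean one, hence attains a positive minimum on the compact unit sphere;
  \<open>C\<close> is the inverse of that minimum.
\<close>

lemma is_norm_bounds_euclidean_norm:
  fixes \<nu> :: "real ^ 'n \<Rightarrow> real"
  assumes "is_norm \<nu>"
  obtains C where "C > 0" "\<And>x. norm x \<le> C * \<nu> x"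
proof -
  note nu = assms[unfolded is_norm_def]
  have nonneg: "0 \<le> \<nu> x" and scale: "\<nu> (r *\<^sub>R x) = \<bar>r\<bar> * \<nu> x"
    and tri: "\<nu> (x + y) \<le> \<nu> x + \<nu> y" and zero: "\<nu> x = 0 \<longleftrightarrow> x = 0" for x y r
    using nu by blast+
  define K where "K = (\<Sum>k\<in>UNIV. \<nu> (axis k 1))"
  have nu_sum: "\<nu> (\<Sum>k\<in>A. f k) \<le> (\<Sum>k\<in>A. \<nu> (f k))" if "finite A" for A :: "'n set" and f
    using that
  proof (induction A)
    case empty
    show ?case using zero[of 0] by simp
  next
    case (insert k A)
    then show ?case using tri[of "f k" "sum f A"] by simp
  qed
  have upper: "\<nu> x \<le> K * norm x" for x
  proof -
    have "x = (\<Sum>k\<in>UNIV. x $ k *\<^sub>R axis k 1)"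
      using basis_expansion[of x] by (simp add: scalar_mult_eq_scaleR)
    then have "\<nu> x = \<nu> (\<Sum>k\<in>UNIV. x $ k *\<^sub>R axis k 1)"
      by simp
    also have "\<dots> \<le> (\<Sum>k\<in>UNIV. \<nu> (x $ k *\<^sub>R axis k 1))"
      by (rule nu_sum) simp
    also have "\<dots> = (\<Sum>k\<in>UNIV. \<bar>x $ k\<bar> * \<nu> (axis k 1))"
      by (simp add: scale)
    also have "\<dots> \<le> (\<Sum>k\<in>UNIV. norm x * \<nu> (axis k 1))"
      by (intro sum_mono mult_right_mono component_le_norm_cart nonneg)
    finally show ?thesis
      by (simp add: K_def sum_distrib_left mult.commute)
  qed
  have K: "0 \<le> K"
    by (simp add: K_def sum_nonneg nonneg)
  have lip: "dist (\<nu> x) (\<nu> y) \<le> K * dist x y" for x y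
  proof -
    have "\<nu> x \<le> \<nu> (x - y) + \<nu> y" "\<nu> y \<le> \<nu> (y - x) + \<nu> x"
      using tri[of "x - y" y] tri[of "y - x" x] by simp_all
    then show ?thesis
      using upper[of "x - y"] upper[of "y - x"]
      by (simp add: dist_norm norm_minus_commute abs_le_iff)
  qed
  have "continuous_on (sphere 0 1) \<nu>"
    using lip K by (intro lipschitz_on_continuous_on[of K]) (auto simp: lipschitz_on_def)
  then obtain x0 where x0: "x0 \<in> sphere 0 1" "\<And>y. y \<in> sphere 0 1 \<Longrightarrow> \<nu> x0 \<le> \<nu> y"
    using continuous_attains_inf[of "sphere (0 :: real ^ 'n) 1" \<nu>] by (auto simp: sphere_eq_empty)
  have pos: "\<nu> x0 > 0"
    using x0(1) nonneg[of x0] zero[of x0] by (cases "x0 = 0") auto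
  have "norm x \<le> inverse (\<nu> x0) * \<nu> x" for x
  proof (cases "x = 0")
    case True
    then show ?thesis using zero[of 0] by simp
  next
    case False
    have "\<nu> x0 \<le> \<nu> (inverse (norm x) *\<^sub>R x)"
      using False by (intro x0(2)) simp
    then show ?thesis
      using False pos by (simp add: scale field_simps)
  qed
  with pos show ?thesis
    by (intro that[of "inverse (\<nu> x0)"]) auto
qed

lemma abs_monomial_le: "\<bar>monomial i t\<bar> \<le> norm t ^ mdegree i"
proof -
  have "\<bar>monomial i t\<bar> = (\<Prod>k\<in>UNIV. \<bar>t $ k\<bar> ^ (i $ k))"
    by (simp add: monomial_def abs_prod power_abs)
  also have "\<dots> \<le> (\<Prod>k\<in>UNIV. norm t ^ (i $ k))"
    by (intro prod_mono conjI power_mono component_le_norm_cart) auto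
  also have "\<dots> = norm t ^ mdegree i"
    by (simp add: mdegree_def power_sum)
  finally show ?thesis .
qed

lemma monomial_sum_le_norm_power:
  fixes \<nu> :: "real ^ 'n \<Rightarrow> real"
  assumes "is_norm \<nu>" "\<And>i. i \<in> I \<Longrightarrow> mdegree i \<le> m"
  obtains B where "B > 0" "\<And>t. (\<Sum>i\<in>I. l i * monomial i t) \<le> B * (\<nu> t ^ m + 1)"
proof -
  obtain C where C: "C > 0" "\<And>x. norm x \<le> C * \<nu> x"
    using is_norm_bounds_euclidean_norm[OF assms(1)] by blast
  have nonneg: "0 \<le> \<nu> t" for t
    using assms(1) by (simp add: is_norm_def)
  have mon: "\<bar>monomial i t\<bar> \<le> (1 + C ^ m) * (\<nu> t ^ m + 1)" if "i \<in> I" for i t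
  proof -
    have "norm t ^ mdegree i \<le> 1 + norm t ^ m"
    proof (cases "norm t \<le> 1")
      case True
      then have "norm t ^ mdegree i \<le> 1"
        by (simp add: power_le_one)
      then show ?thesis
        by (simp add: add_increasing2)
    next
      case False
      then have "norm t ^ mdegree i \<le> norm t ^ m"
        using assms(2)[OF that] by (intro power_increasing) auto
      then show ?thesis by simp
    qed
    also have "norm t ^ m \<le> (C * \<nu> t) ^ m"
      using C by (intro power_mono) auto
    finally have "norm t ^ mdegree i \<le> 1 + C ^ m * \<nu> t ^ m"
      by (simp add: power_mult_distrib)
    also have "\<dots> \<le> (1 + C ^ m) * (\<nu> t ^ m + 1)"
      using C nonneg[of t] by (simp add: algebra_simps)
    finally show ?thesis
      using abs_monomial_le[of i t] by simp
  qed
  define B where "B = (\<Sum>i\<in>I. \<bar>l i\<bar>) * (1 + C ^ m) + 1"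
  have "(\<Sum>i\<in>I. l i * monomial i t) \<le> B * (\<nu> t ^ m + 1)" for t
  proof -
    have "(\<Sum>i\<in>I. l i * monomial i t) \<le> (\<Sum>i\<in>I. \<bar>l i\<bar> * ((1 + C ^ m) * (\<nu> t ^ m + 1)))"
    proof (rule sum_mono)
      fix i assume "i \<in> I"
      then have "\<bar>l i\<bar> * \<bar>monomial i t\<bar> \<le> \<bar>l i\<bar> * ((1 + C ^ m) * (\<nu> t ^ m + 1))"
        by (intro mult_left_mono mon) auto
      then show "l i * monomial i t \<le> \<bar>l i\<bar> * ((1 + C ^ m) * (\<nu> t ^ m + 1))"
        using abs_ge_self[of "l i * monomial i t"] by (simp add: abs_mult)
    qed
    also have "\<dots> = (B - 1) * (\<nu> t ^ m + 1)"
      by (simp add: B_def sum_distrib_right mult.assoc)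
    also have "\<dots> \<le> B * (\<nu> t ^ m + 1)"
      using nonneg[of t] by (intro mult_right_mono) auto
    finally show ?thesis .
  qed
  moreover have "B > 0"
    using C by (simp add: B_def add_nonneg_pos sum_nonneg)
  ultimately show ?thesis
    using that by blast
qed

section \<open>Maximising the dual functional of an exponential family\<close>

lemma bounded_family_convergent_subsequence:
  fixes f :: "nat \<Rightarrow> 'i \<Rightarrow> real"
  assumes "finite I" "\<And>n i. i \<in> I \<Longrightarrow> \<bar>f n i\<bar> \<le> R"
  obtains \<sigma> e where "strict_mono \<sigma>" "\<And>i. i \<in> I \<Longrightarrow> (\<lambda>n. f (\<sigma> n) i) \<longlonglongrightarrow> e i"
proof -
  have "\<exists>\<sigma> e. strict_mono \<sigma> \<and> (\<forall>i\<in>I. (\<lambda>n. f (\<sigma> n) i) \<longlonglongrightarrow> e i)"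
    using assms
  proof (induction I rule: finite_induct)
    case empty
    show ?case by (auto intro: strict_mono_id)
  next
    case (insert k I)
    then have "\<exists>\<sigma> e. strict_mono \<sigma> \<and> (\<forall>i\<in>I. (\<lambda>n. f (\<sigma> n) i) \<longlonglongrightarrow> e i)"
      by blast
    then obtain \<sigma> e where \<sigma>: "strict_mono \<sigma>" "\<And>i. i \<in> I \<Longrightarrow> (\<lambda>n. f (\<sigma> n) i) \<longlonglongrightarrow> e i"
      by blast
    have "bounded (range (\<lambda>n. f (\<sigma> n) k))"
      using insert.prems by (auto simp: bounded_iff)
    then obtain x \<tau> where \<tau>: "strict_mono \<tau>" "((\<lambda>n. f (\<sigma> n) k) \<circ> \<tau>) \<longlonglongrightarrow> x"
      using bounded_imp_convergent_subsequence by blast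
    have "(\<lambda>n. f ((\<sigma> \<circ> \<tau>) n) i) \<longlonglongrightarrow> (e(k := x)) i" if "i \<in> insert k I" for i
    proof (cases "i = k")
      case True
      then show ?thesis using \<tau>(2) by (simp add: o_def)
    next
      case False
      then show ?thesis
        using that LIMSEQ_subseq_LIMSEQ[OF \<sigma>(2) \<tau>(1), of i] by (simp add: o_def)
    qed
    moreover have "strict_mono (\<sigma> \<circ> \<tau>)"
      using \<sigma>(1) \<tau>(1) by (rule strict_mono_o)
    ultimately show ?case by blast
  qed
  then show ?thesis using that by blast
qed

text \<open>
  An exponential family with statistics \<open>\<phi>\<close> and base density \<open>w\<close>, all of whose exponential moments
  are finite. The functional \<open>dual\<close> below is the one that arises as the dual of minimising a relative entropy
  under the moment constraints \<open>g\<close>.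
\<close>

locale exponential_dual =
  fixes M :: "'a measure" and I :: "'i set" and g :: "'i \<Rightarrow> real"
    and \<phi> :: "'i \<Rightarrow> 'a \<Rightarrow> real" and w :: "'a \<Rightarrow> real"
  assumes finite_I: "finite I"
    and \<phi>_measurable [measurable]: "\<And>i. i \<in> I \<Longrightarrow> \<phi> i \<in> borel_measurable M"
    and w_measurable [measurable]: "w \<in> borel_measurable M"
    and w_pos: "AE t in M. 0 < w t"
    and integrable_exp: "\<And>l. integrable M (\<lambda>t. exp ((\<Sum>i\<in>I. l i * \<phi> i t) - 1) * w t)"
begin

definition mass :: "('i \<Rightarrow> real) \<Rightarrow> real" where
  "mass l = (LINT t|M. exp ((\<Sum>i\<in>I. l i * \<phi> i t) - 1) * w t)"

definition dual :: "('i \<Rightarrow> real) \<Rightarrow> real" where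
  "dual l = (\<Sum>i\<in>I. g i * l i) - mass l"

lemma mass_nonneg: "0 \<le> mass l"
  unfolding mass_def using w_pos by (intro integral_nonneg_AE) (auto elim!: eventually_mono)

lemma nn_integral_mass:
  "(\<integral>\<^sup>+t. ennreal (exp ((\<Sum>i\<in>I. l i * \<phi> i t) - 1) * w t) \<partial>M) = ennreal (mass l)"
  unfolding mass_def using w_pos
  by (intro nn_integral_eq_integral integrable_exp) (auto elim!: eventually_mono)

lemma mass_cong: "(\<And>i. i \<in> I \<Longrightarrow> l i = l' i) \<Longrightarrow> mass l = mass l'"
  by (simp add: mass_def)

lemma dual_cong: "(\<And>i. i \<in> I \<Longrightarrow> l i = l' i) \<Longrightarrow> dual l = dual l'"
  using mass_cong[of l l'] by (simp add: dual_def)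

text \<open>
  Where the limit direction is positive, the integrand divided by \<open>r n\<close> tends to infinity. By Fatou's lemma
  this can happen only on a null set, since the integrals stay below \<open>K\<close>.
\<close>

lemma limit_direction_nonpos:
  assumes r: "filterlim r at_top sequentially" "\<And>n. 0 < r n"
    and lim: "\<And>i. i \<in> I \<Longrightarrow> (\<lambda>n. \<mu> n i / r n) \<longlonglongrightarrow> e i"
    and mass: "\<And>n. mass (\<mu> n) \<le> K * r n"
  shows "AE t in M. (\<Sum>i\<in>I. e i * \<phi> i t) \<le> 0"
proof -
  define f where "f n t = exp ((\<Sum>i\<in>I. \<mu> n i * \<phi> i t) - 1) * w t / r n" for n t
  have [measurable]: "f n \<in> borel_measurable M" for n
    unfolding f_def by measurable
  have int: "(\<integral>\<^sup>+t. ennreal (f n t) \<partial>M) \<le> ennreal K" for n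
  proof -
    have "(\<integral>\<^sup>+t. ennreal (f n t) \<partial>M)
        = (\<integral>\<^sup>+t. ennreal (exp ((\<Sum>i\<in>I. \<mu> n i * \<phi> i t) - 1) * w t) / ennreal (r n) \<partial>M)"
    proof (rule nn_integral_cong_AE, use w_pos in eventually_elim)
      case (elim t)
      then show ?case
        using r(2)[of n] by (simp add: f_def divide_ennreal)
    qed
    also have "\<dots> = ennreal (mass (\<mu> n)) / ennreal (r n)"
      by (simp add: nn_integral_divide nn_integral_mass)
    also have "\<dots> = ennreal (mass (\<mu> n) / r n)"
      using r(2)[of n] by (simp add: divide_ennreal mass_nonneg)
    also have "\<dots> \<le> ennreal K"
      using r(2)[of n] mass[of n] by (intro ennreal_leI) (simp add: divide_le_eq)
    finally show ?thesis .
  qed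
  have "(\<integral>\<^sup>+t. liminf (\<lambda>n. ennreal (f n t)) \<partial>M) \<le> liminf (\<lambda>n. \<integral>\<^sup>+t. ennreal (f n t) \<partial>M)"
    by (rule nn_integral_liminf) measurable
  also have "\<dots> \<le> liminf (\<lambda>n :: nat. ennreal K)"
    by (intro Liminf_mono always_eventually allI int)
  also have "\<dots> = ennreal K"
    by (simp add: Liminf_const)
  finally have fin: "(\<integral>\<^sup>+t. liminf (\<lambda>n. ennreal (f n t)) \<partial>M) \<noteq> \<infinity>"
    by (auto simp: top_unique)
  have "AE t in M. liminf (\<lambda>n. ennreal (f n t)) \<noteq> \<infinity>"
    by (rule nn_integral_PInf_AE[OF _ fin]) measurable
  with w_pos show ?thesis
  proof eventually_elim
    case (elim t)
    show ?case
    proof (rule ccontr)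
      define \<delta> where "\<delta> = (\<Sum>i\<in>I. e i * \<phi> i t) / 2"
      assume "\<not> (\<Sum>i\<in>I. e i * \<phi> i t) \<le> 0"
      then have \<delta>: "\<delta> > 0" "\<delta> < (\<Sum>i\<in>I. e i * \<phi> i t)"
        by (auto simp: \<delta>_def)
      have "(\<lambda>n. \<Sum>i\<in>I. \<mu> n i / r n * \<phi> i t) \<longlonglongrightarrow> (\<Sum>i\<in>I. e i * \<phi> i t)"
        by (intro tendsto_intros lim)
      then have "\<forall>\<^sub>F n in sequentially. \<delta> < (\<Sum>i\<in>I. \<mu> n i / r n * \<phi> i t)"
        using \<delta>(2) by (rule order_tendstoD)
      then have ev: "\<forall>\<^sub>F n in sequentially. exp (-1) * w t * \<delta>\<^sup>2 / 2 * r n \<le> f n t"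
      proof eventually_elim
        case (elim n)
        have "(\<Sum>i\<in>I. \<mu> n i / r n * \<phi> i t) = (\<Sum>i\<in>I. \<mu> n i * \<phi> i t) / r n"
          by (simp add: sum_divide_distrib)
        with elim have le: "\<delta> * r n \<le> (\<Sum>i\<in>I. \<mu> n i * \<phi> i t)"
          using r(2)[of n] by (simp add: less_divide_eq)
        have nonneg: "0 \<le> \<delta> * r n"
          using \<delta>(1) r(2)[of n] by simp
        then have "(\<delta> * r n)\<^sup>2 / 2 \<le> exp (\<delta> * r n)"
          using exp_lower_Taylor_quadratic[OF nonneg] by linarith
        also have "\<dots> \<le> exp (\<Sum>i\<in>I. \<mu> n i * \<phi> i t)"
          using le by simp
        finally have "(\<delta> * r n)\<^sup>2 / 2 * (exp (-1) * w t / r n)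
            \<le> exp (\<Sum>i\<in>I. \<mu> n i * \<phi> i t) * (exp (-1) * w t / r n)"
          using \<open>0 < w t\<close> r(2)[of n] by (intro mult_right_mono) auto
        then show ?case
          using r(2)[of n] by (simp add: f_def exp_diff exp_minus power2_eq_square field_simps)
      qed
      \<comment> \<open>The quadratic bound \<open>exp x \<ge> x\<^sup>2 / 2\<close> beats the division by \<open>r n\<close>.\<close>
      have "filterlim (\<lambda>n. exp (-1) * w t * \<delta>\<^sup>2 / 2 * r n) at_top sequentially"
        using \<open>0 < w t\<close> \<delta>(1) r(1) by (intro filterlim_tendsto_pos_mult_at_top[OF tendsto_const]) auto
      then have "filterlim (\<lambda>n. f n t) at_top sequentially"
        by (rule filterlim_at_top_mono) (rule ev)
      then have "(\<lambda>n. ennreal (f n t)) \<longlonglongrightarrow> top"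
        by (simp add: ennreal_tendsto_top_eq_at_top)
      then have "liminf (\<lambda>n. ennreal (f n t)) = top"
        by (intro lim_imp_Liminf) auto
      with elim show False by simp
    qed
  qed
qed

text \<open>
  Along the negative direction \<open>e\<close> the mass tends to zero by dominated convergence while the linear part does not
  decrease. The shift by \<open>u\<close> times \<open>c\<close> only rescales the mass by \<open>exp u\<close>, but raises the linear part by an
  amount chosen to exceed \<open>S\<close> by at least 1; it then suffices to go along \<open>e\<close> until the mass is below 1.
\<close>

lemma dual_unbounded_in_negative_direction:
  assumes one: "AE t in M. (\<Sum>i\<in>I. c i * \<phi> i t) = 1" and c: "(\<Sum>i\<in>I. c i * g i) > 0"
    and neg: "AE t in M. (\<Sum>i\<in>I. e i * \<phi> i t) < 0" and e: "(\<Sum>i\<in>I. g i * e i) \<ge> 0"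
  shows "\<exists>l. S < dual l"
proof -
  define u where "u = (\<bar>S\<bar> + 1) / (\<Sum>i\<in>I. c i * g i)"
  define l where "l n i = real n * e i + u * c i" for n i
  have "(\<lambda>n. mass (l n)) \<longlonglongrightarrow> (LINT t|M. 0)"
    unfolding mass_def
  proof (rule integral_dominated_convergence)
    show "integrable M (\<lambda>t. exp ((\<Sum>i\<in>I. (u * c i) * \<phi> i t) - 1) * w t)"
      by (rule integrable_exp)
    have expand: "(\<Sum>i\<in>I. l n i * \<phi> i t)
        = real n * (\<Sum>i\<in>I. e i * \<phi> i t) + (\<Sum>i\<in>I. (u * c i) * \<phi> i t)" for n t
      by (simp add: l_def sum_distrib_left sum.distrib algebra_simps)
    show "AE t in M. (\<lambda>n. exp ((\<Sum>i\<in>I. l n i * \<phi> i t) - 1) * w t) \<longlonglongrightarrow> 0"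
      using neg
    proof eventually_elim
      case (elim t)
      let ?E = "\<Sum>i\<in>I. e i * \<phi> i t" and ?U = "\<Sum>i\<in>I. (u * c i) * \<phi> i t"
      have "(\<lambda>n. exp ?E ^ n * (exp (?U - 1) * w t)) \<longlonglongrightarrow> 0 * (exp (?U - 1) * w t)"
        using elim by (intro tendsto_mult tendsto_const LIMSEQ_power_zero) simp
      then show ?case
        unfolding expand by (simp add: exp_of_nat_mult exp_add exp_diff mult_ac)
    qed
    show "AE t in M. norm (exp ((\<Sum>i\<in>I. l n i * \<phi> i t) - 1) * w t)
        \<le> exp ((\<Sum>i\<in>I. (u * c i) * \<phi> i t) - 1) * w t" for n
      using neg w_pos
    proof eventually_elim
      case (elim t)
      then have "real n * (\<Sum>i\<in>I. e i * \<phi> i t) \<le> 0"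
        by (simp add: mult_nonneg_nonpos)
      with elim show ?case
        unfolding expand by (simp add: abs_mult)
    qed
  qed measurable
  then have "(\<lambda>n. mass (l n)) \<longlonglongrightarrow> 0" by simp
  then have "\<forall>\<^sub>F n in sequentially. mass (l n) < 1"
    by (rule order_tendstoD) simp
  then obtain n where n: "mass (l n) < 1"
    by (auto simp: eventually_sequentially)
  have "(\<Sum>i\<in>I. g i * l n i) = real n * (\<Sum>i\<in>I. g i * e i) + u * (\<Sum>i\<in>I. c i * g i)"
    by (simp add: l_def sum_distrib_left sum.distrib algebra_simps)
  also have "u * (\<Sum>i\<in>I. c i * g i) = \<bar>S\<bar> + 1"
    using c by (simp add: u_def)
  finally have "(\<Sum>i\<in>I. g i * l n i) \<ge> \<bar>S\<bar> + 1"
    using e by simp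
  with n have "S < dual (l n)"
    by (simp add: dual_def)
  then show ?thesis
    by blast
qed

text \<open>
  The coercivity statement: a sequence escaping to infinity inside a superlevel set would have a
  limiting direction \<open>e\<close> that is negative almost everywhere and satisfies \<open>g \<cdot> e \<ge> 0\<close>, so \<open>dual\<close> would be unbounded.
  The linear independence assumption \<open>indep\<close> excludes directions that vanish on a set of positive measure, along which
  the mass would not tend to zero.
\<close>

lemma superlevel_bounded:
  assumes indep: "\<And>e. \<exists>i\<in>I. e i \<noteq> 0 \<Longrightarrow> AE t in M. (\<Sum>i\<in>I. e i * \<phi> i t) \<noteq> 0"
    and one: "AE t in M. (\<Sum>i\<in>I. c i * \<phi> i t) = 1" and c: "(\<Sum>i\<in>I. c i * g i) > 0"
    and bdd: "\<And>l. dual l \<le> S"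
  obtains R where "\<And>l i. B \<le> dual l \<Longrightarrow> i \<in> I \<Longrightarrow> \<bar>l i\<bar> \<le> R"
proof (rule ccontr)
  define N where "N l = (\<Sum>i\<in>I. \<bar>l i\<bar>)" for l :: "'i \<Rightarrow> real"
  have N_ge: "\<bar>l i\<bar> \<le> N l" if "i \<in> I" for l i
    unfolding N_def using that finite_I by (intro member_le_sum) auto
  assume "\<not> thesis"
  then have "\<exists>l. B \<le> dual l \<and> real (Suc n) < N l" for n
    using that[of "real (Suc n)"] N_ge by (meson dual_order.trans not_less)
  then obtain \<mu> where \<mu>: "\<And>n. B \<le> dual (\<mu> n)" "\<And>n. real (Suc n) < N (\<mu> n)"
    by metis
  have N_ge1: "1 \<le> N (\<mu> n)" for n
    using \<mu>(2)[of n] by simp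
  have bounded: "\<bar>\<mu> n i / N (\<mu> n)\<bar> \<le> 1" if "i \<in> I" for n i
    using N_ge[OF that, of "\<mu> n"] N_ge1[of n] by simp
  obtain \<sigma> e where \<sigma>: "strict_mono \<sigma>"
    and lim: "\<And>i. i \<in> I \<Longrightarrow> (\<lambda>n. \<mu> (\<sigma> n) i / N (\<mu> (\<sigma> n))) \<longlonglongrightarrow> e i"
    using bounded_family_convergent_subsequence[OF finite_I, of "\<lambda>n i. \<mu> n i / N (\<mu> n)" 1] bounded
    by blast
  define r where "r n = N (\<mu> (\<sigma> n))" for n
  have r_ge1: "1 \<le> r n" for n
    by (simp add: r_def N_ge1)
  have r_top: "filterlim r at_top sequentially"
  proof (rule filterlim_at_top_mono[OF filterlim_real_sequentially], rule always_eventually, rule allI)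
    fix n
    show "real n \<le> r n"
      using \<mu>(2)[of "\<sigma> n"] seq_suble[OF \<sigma>, of n] by (simp add: r_def)
  qed
  have lim': "(\<lambda>n. \<mu> (\<sigma> n) i / r n) \<longlonglongrightarrow> e i" if "i \<in> I" for i
    using lim[OF that] by (simp add: r_def)

  have "(\<lambda>n. \<Sum>i\<in>I. \<bar>\<mu> (\<sigma> n) i / r n\<bar>) \<longlonglongrightarrow> (\<Sum>i\<in>I. \<bar>e i\<bar>)"
    by (intro tendsto_intros lim')
  moreover have "(\<Sum>i\<in>I. \<bar>\<mu> (\<sigma> n) i / r n\<bar>) = 1" for n
  proof -
    have "(\<Sum>i\<in>I. \<bar>\<mu> (\<sigma> n) i / r n\<bar>) = r n / r n"
      unfolding r_def using N_ge1[of "\<sigma> n"]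
      by (simp add: N_def[of "\<mu> (\<sigma> n)"] flip: sum_divide_distrib)
    then show ?thesis
      using r_ge1[of n] by simp
  qed
  ultimately have "(\<Sum>i\<in>I. \<bar>e i\<bar>) = 1"
    using LIMSEQ_unique[OF _ tendsto_const[of "1 :: real"]] by simp
  then have "\<exists>i\<in>I. e i \<noteq> 0"
    by (metis abs_zero sum.neutral zero_neq_one)
  then have nonzero: "AE t in M. (\<Sum>i\<in>I. e i * \<phi> i t) \<noteq> 0"
    by (rule indep)

  define G where "G = (\<Sum>i\<in>I. \<bar>g i\<bar>)"
  have "AE t in M. (\<Sum>i\<in>I. e i * \<phi> i t) \<le> 0"
  proof (rule limit_direction_nonpos[OF r_top _ lim'])
    show "0 < r n" for n
      using r_ge1[of n] by simp
    show "mass (\<mu> (\<sigma> n)) \<le> (G + \<bar>B\<bar>) * r n" for n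
    proof -
      have "(\<Sum>i\<in>I. g i * \<mu> (\<sigma> n) i) \<le> (\<Sum>i\<in>I. \<bar>g i\<bar> * r n)"
      proof (rule sum_mono)
        fix i assume "i \<in> I"
        then have "\<bar>g i\<bar> * \<bar>\<mu> (\<sigma> n) i\<bar> \<le> \<bar>g i\<bar> * r n"
          unfolding r_def by (intro mult_left_mono N_ge) auto
        then show "g i * \<mu> (\<sigma> n) i \<le> \<bar>g i\<bar> * r n"
          using abs_ge_self[of "g i * \<mu> (\<sigma> n) i"] by (simp add: abs_mult)
      qed
      also have "\<dots> = G * r n"
        by (simp add: G_def sum_distrib_right)
      finally have "mass (\<mu> (\<sigma> n)) \<le> G * r n + \<bar>B\<bar> * 1"
        using \<mu>(1)[of "\<sigma> n"] by (simp add: dual_def)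
      also have "\<dots> \<le> G * r n + \<bar>B\<bar> * r n"
        using r_ge1[of n] by (intro add_left_mono mult_left_mono) auto
      finally show ?thesis
        by (simp add: algebra_simps)
    qed
  qed
  with nonzero have neg: "AE t in M. (\<Sum>i\<in>I. e i * \<phi> i t) < 0"
    by eventually_elim auto

  have "0 \<le> (\<Sum>i\<in>I. g i * e i)"
  proof (rule LIMSEQ_le)
    show "(\<lambda>n. B / r n) \<longlonglongrightarrow> 0"
      by (rule tendsto_divide_0[OF tendsto_const filterlim_at_top_imp_at_infinity[OF r_top]])
    show "(\<lambda>n. \<Sum>i\<in>I. g i * (\<mu> (\<sigma> n) i / r n)) \<longlonglongrightarrow> (\<Sum>i\<in>I. g i * e i)"
      by (intro tendsto_intros lim')
    have "B / r n \<le> (\<Sum>i\<in>I. g i * (\<mu> (\<sigma> n) i / r n))" for n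
    proof -
      have "B \<le> (\<Sum>i\<in>I. g i * \<mu> (\<sigma> n) i)"
        using \<mu>(1)[of "\<sigma> n"] mass_nonneg[of "\<mu> (\<sigma> n)"] by (simp add: dual_def)
      then have "B / r n \<le> (\<Sum>i\<in>I. g i * \<mu> (\<sigma> n) i) / r n"
        using r_ge1[of n] by (intro divide_right_mono) auto
      then show ?thesis
        by (simp add: sum_divide_distrib)
    qed
    then show "\<exists>n0. \<forall>n\<ge>n0. B / r n \<le> (\<Sum>i\<in>I. g i * (\<mu> (\<sigma> n) i / r n))"
      by blast
  qed
  then obtain l where "S < dual l"
    using dual_unbounded_in_negative_direction[OF one c neg] by blast
  with bdd[of l] show False by simp
qed

text \<open>
  Fatou's lemma gives lower semicontinuity of the mass; the linear part is continuous.
\<close>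

lemma dual_upper_semicontinuous:
  assumes lim: "\<And>i. i \<in> I \<Longrightarrow> (\<lambda>n. \<mu> n i) \<longlonglongrightarrow> l i" and dual: "(\<lambda>n. dual (\<mu> n)) \<longlonglongrightarrow> S"
  shows "S \<le> dual l"
proof -
  have "(\<lambda>n. (\<Sum>i\<in>I. g i * \<mu> n i) - dual (\<mu> n)) \<longlonglongrightarrow> (\<Sum>i\<in>I. g i * l i) - S"
    by (intro tendsto_intros lim dual)
  then have mass: "(\<lambda>n. mass (\<mu> n)) \<longlonglongrightarrow> (\<Sum>i\<in>I. g i * l i) - S"
    by (simp add: dual_def)
  have "ennreal (mass l)
      = (\<integral>\<^sup>+t. liminf (\<lambda>n. ennreal (exp ((\<Sum>i\<in>I. \<mu> n i * \<phi> i t) - 1) * w t)) \<partial>M)"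
    unfolding nn_integral_mass[symmetric]
  proof (intro nn_integral_cong lim_imp_Liminf[symmetric] tendsto_ennrealI tendsto_intros lim)
  qed auto
  also have "\<dots> \<le> liminf (\<lambda>n. ennreal (mass (\<mu> n)))"
    unfolding nn_integral_mass[symmetric] by (intro nn_integral_liminf) measurable
  also have "\<dots> = ennreal ((\<Sum>i\<in>I. g i * l i) - S)"
    by (intro lim_imp_Liminf tendsto_ennrealI mass) simp
  finally have "mass l \<le> (\<Sum>i\<in>I. g i * l i) - S"
    using LIMSEQ_le_const[OF mass, of 0] mass_nonneg by (subst (asm) ennreal_le_iff) auto
  then show ?thesis
    by (simp add: dual_def)
qed

theorem dual_maximum_exists:
  assumes indep: "\<And>e. \<exists>i\<in>I. e i \<noteq> 0 \<Longrightarrow> AE t in M. (\<Sum>i\<in>I. e i * \<phi> i t) \<noteq> 0"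
    and one: "AE t in M. (\<Sum>i\<in>I. c i * \<phi> i t) = 1" and c: "(\<Sum>i\<in>I. c i * g i) > 0"
    and bdd: "\<And>l. dual l \<le> S"
  obtains l where "\<And>l'. dual l' \<le> dual l"
proof -
  define s where "s = (SUP l. dual l)"
  have above: "bdd_above (range dual)"
    using bdd by (auto simp: bdd_above_def)
  then have le_s: "dual l \<le> s" for l
    by (auto simp: s_def intro: cSUP_upper)
  have "\<exists>l. s - inverse (real (Suc n)) < dual l" for n
    using less_cSUP_iff[OF _ above, of "s - inverse (real (Suc n))"] by (auto simp: s_def)
  then obtain \<mu> where \<mu>: "\<And>n. s - inverse (real (Suc n)) < dual (\<mu> n)"
    by metis
  have "(\<lambda>n. s - inverse (real (Suc n))) \<longlonglongrightarrow> s"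
    using LIMSEQ_inverse_real_of_nat_add_minus[of s] by simp
  then have lim: "(\<lambda>n. dual (\<mu> n)) \<longlonglongrightarrow> s"
    by (rule tendsto_sandwich[rotated 2, OF _ tendsto_const])
      (intro always_eventually allI less_imp_le[OF \<mu>] le_s)+
  obtain R where R: "\<And>l i. s - 1 \<le> dual l \<Longrightarrow> i \<in> I \<Longrightarrow> \<bar>l i\<bar> \<le> R"
    using superlevel_bounded[OF indep one c bdd] by blast
  have "s - 1 \<le> dual (\<mu> n)" for n
  proof -
    have "inverse (real (Suc n)) \<le> 1"
      by (simp add: inverse_le_1_iff)
    with \<mu>[of n] show ?thesis by simp
  qed
  then have "\<bar>\<mu> n i\<bar> \<le> R" if "i \<in> I" for n i
    using R that by blast
  then obtain \<sigma> l where "strict_mono \<sigma>" "\<And>i. i \<in> I \<Longrightarrow> (\<lambda>n. \<mu> (\<sigma> n) i) \<longlonglongrightarrow> l i"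
    using bounded_family_convergent_subsequence[OF finite_I, of \<mu> R] by blast
  then have "s \<le> dual l"
    using LIMSEQ_subseq_LIMSEQ[OF lim, of \<sigma>]
    by (intro dual_upper_semicontinuous[of "\<lambda>n. \<mu> (\<sigma> n)"]) (auto simp: o_def)
  then show ?thesis
    using le_s that order_trans by blast
qed

end

section \<open>The dual functional of a moment problem\<close>

lemma monomial_measurable: "monomial i \<in> borel_measurable (lebesgue_on T)"
proof (intro measurable_restrict_space1 measurable_completion)
  show "monomial i \<in> borel_measurable lborel"
    unfolding monomial_def by measurable
qed

theorem proposition5:
  fixes T :: "(real ^ 'n) set"
    and I :: "(nat ^ 'n) set"
    and g c :: "nat ^ 'n \<Rightarrow> real"
    and m :: nat
    and \<nu> :: "real ^ 'n \<Rightarrow> real"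
    and a \<rho> :: "real ^ 'n \<Rightarrow> ereal"
  assumes "closed T"
    and "finite I" and "0 \<in> I"
    and "g 0 = 1"
    and "m = Max (mdegree ` I)"
    and "is_norm \<nu>"
    and "a \<in> borel_measurable (lebesgue_on T)"
    and "\<rho> \<in> borel_measurable (lebesgue_on T)"
    and "AE t in lebesgue_on T. 0 < a t \<and> a t < \<infinity>"
    and "AE t in lebesgue_on T. 0 < \<rho> t \<and> \<rho> t < \<infinity>"
    and "\<And>\<alpha> :: real. \<alpha> > 0 \<Longrightarrow>
           (\<integral>\<^sup>+ t. ennreal (exp ((\<nu> t ^ m + 1) / (\<alpha> * real_of_ereal (a t)))) * e2ennreal (\<rho> t)
              \<partial>lebesgue_on T) < \<infinity>"
    and "independent_of_monomials T (I - {0}) a"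
    and "\<forall>t\<in>T. a t = ereal (\<Sum>i\<in>I. c i * monomial i t)"
    and "(\<Sum>i\<in>I. c i * g i) > 0"
    and "(SUP l \<in> I \<rightarrow>\<^sub>E (UNIV :: real set). ereal (dual_functional T I g a \<rho> l)) < \<infinity>"
  shows "\<exists>l' \<in> I \<rightarrow>\<^sub>E (UNIV :: real set).
           (SUP l \<in> I \<rightarrow>\<^sub>E (UNIV :: real set). ereal (dual_functional T I g a \<rho> l))
             = ereal (dual_functional T I g a \<rho> l')"
proof -
  let ?M = "lebesgue_on T"
  define \<phi> where "\<phi> i t = monomial i t / real_of_ereal (a t)" for i t
  define w where "w t = real_of_ereal (\<rho> t)" for t
  have T: "T \<in> sets lebesgue"
    using \<open>closed T\<close> by (simp add: borel_closed)
  have [measurable]: "monomial i \<in> borel_measurable ?M" for i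
    by (rule monomial_measurable)
  have [measurable]: "a \<in> borel_measurable ?M" "\<rho> \<in> borel_measurable ?M"
    by (fact assms)+
  have a_pos: "AE t in ?M. 0 < real_of_ereal (a t)"
    using assms(9) by eventually_elim (simp add: zero_less_real_of_ereal)
  have w_pos: "AE t in ?M. 0 < w t"
    using assms(10) by eventually_elim (simp add: w_def zero_less_real_of_ereal)
  have sum_\<phi>: "(\<Sum>i\<in>I. l i * \<phi> i t) = (\<Sum>i\<in>I. l i * monomial i t) / real_of_ereal (a t)" for l t
    by (simp add: \<phi>_def sum_divide_distrib)
  have \<phi>_meas [measurable]: "\<phi> i \<in> borel_measurable ?M" for i
    unfolding \<phi>_def by measurable
  have w_meas [measurable]: "w \<in> borel_measurable ?M"
    unfolding w_def by measurable
  interpret exponential_dual ?M I g \<phi> w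
  proof
    show "integrable ?M (\<lambda>t. exp ((\<Sum>i\<in>I. l i * \<phi> i t) - 1) * w t)" for l
    proof (rule integrableI_nonneg)
      show "AE t in ?M. 0 \<le> exp ((\<Sum>i\<in>I. l i * \<phi> i t) - 1) * w t"
        using w_pos by eventually_elim simp
      \<comment> \<open>If \<open>B * (\<nu> t ^ m + 1)\<close> bounds the exponent's numerator, the hypothesis with \<open>\<alpha> = 1 / B\<close> dominates the integrand.\<close>
      have "mdegree i \<le> m" if "i \<in> I" for i
        using that \<open>finite I\<close> \<open>m = _\<close> by simp
      then obtain B where B: "B > 0" "\<And>t. (\<Sum>i\<in>I. l i * monomial i t) \<le> B * (\<nu> t ^ m + 1)"
        using monomial_sum_le_norm_power[OF \<open>is_norm \<nu>\<close>] by blast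
      have "(\<integral>\<^sup>+t. ennreal (exp ((\<Sum>i\<in>I. l i * \<phi> i t) - 1) * w t) \<partial>?M)
          \<le> (\<integral>\<^sup>+t. ennreal (exp ((\<nu> t ^ m + 1) / (inverse B * real_of_ereal (a t)))) * e2ennreal (\<rho> t) \<partial>?M)"
      proof (rule nn_integral_mono_AE, use a_pos w_pos assms(10) in eventually_elim)
        case (elim t)
        have "(\<Sum>i\<in>I. l i * \<phi> i t) - 1 \<le> (\<Sum>i\<in>I. l i * monomial i t) / real_of_ereal (a t)"
          by (simp add: sum_\<phi>)
        also have "\<dots> \<le> B * (\<nu> t ^ m + 1) / real_of_ereal (a t)"
          using elim B by (intro divide_right_mono) auto
        also have "\<dots> = (\<nu> t ^ m + 1) / (inverse B * real_of_ereal (a t))"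
          using B(1) by (simp add: field_simps)
        finally have "ennreal (exp ((\<Sum>i\<in>I. l i * \<phi> i t) - 1))
            \<le> ennreal (exp ((\<nu> t ^ m + 1) / (inverse B * real_of_ereal (a t))))"
          by (intro ennreal_leI) simp
        moreover have "e2ennreal (\<rho> t) = ennreal (w t)"
          using elim by (cases "\<rho> t") (auto simp: w_def ennreal.rep_eq e2ennreal_ereal)
        ultimately show ?case
          using elim by (simp add: ennreal_mult mult_right_mono)
      qed
      also have "\<dots> < \<infinity>"
        using B(1) by (intro assms(11)) simp
      finally show "(\<integral>\<^sup>+t. ennreal (exp ((\<Sum>i\<in>I. l i * \<phi> i t) - 1) * w t) \<partial>?M) < \<infinity>" .
    qed measurable
  qed (use \<open>finite I\<close> w_pos \<phi>_meas w_meas in simp_all)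
  have dual_eq: "dual_functional T I g a \<rho> l = dual l" for l
    by (simp add: dual_functional_def dual_def mass_def sum_\<phi> w_def)

  have indep: "AE t in ?M. (\<Sum>i\<in>I. e i * \<phi> i t) \<noteq> 0" if "\<exists>i\<in>I. e i \<noteq> 0" for e
  proof -
    have "AE t in lebesgue. (\<Sum>i\<in>I. e i * monomial i t) \<noteq> 0"
      using that \<open>finite I\<close> by (auto intro: AE_lebesgue_monomial_sum_nonzero)
    then have "AE t in ?M. (\<Sum>i\<in>I. e i * monomial i t) \<noteq> 0"
      using T by (subst AE_restrict_space_iff) (auto elim!: eventually_mono)
    with a_pos show ?thesis
      by eventually_elim (simp add: sum_\<phi>)
  qed
  have one: "AE t in ?M. (\<Sum>i\<in>I. c i * \<phi> i t) = 1"
  proof -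
    have "AE t in ?M. t \<in> T"
      by (rule AE_I2) (simp add: space_restrict_space)
    with a_pos show ?thesis
    proof eventually_elim
      case (elim t)
      then show ?case
        using assms(13) by (simp add: sum_\<phi>)
    qed
  qed

  let ?X = "I \<rightarrow>\<^sub>E (UNIV :: real set)"
  define S where "S = (SUP l \<in> ?X. ereal (dual_functional T I g a \<rho> l))"
  \<comment> \<open>The functional depends on the coordinates in \<open>I\<close> alone, so passing between arbitrary and extensional
     families does not change the supremum.\<close>
  have le_S: "ereal (dual l) \<le> S" for l
  proof -
    have "dual l = dual (restrict l I)"
      by (rule dual_cong) simp
    then show ?thesis
      unfolding S_def dual_eq by (auto intro!: SUP_upper)
  qed
  have "S < \<infinity>"
    using assms(15) by (simp add: S_def)
  with le_S[of undefined] obtain s where s: "S = ereal s"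
    by (cases S) auto
  obtain l where l: "\<And>l'. dual l' \<le> dual l"
    using dual_maximum_exists[OF indep one assms(14), of s] le_S unfolding s by auto
  have max: "dual (restrict l I) = dual l"
    by (rule dual_cong) simp
  have "S = ereal (dual (restrict l I))"
    unfolding max
  proof (rule antisym)
    show "S \<le> ereal (dual l)"
      unfolding S_def dual_eq by (intro SUP_least) (simp add: l)
  qed (rule le_S)
  then show ?thesis
    by (intro bexI[of _ "restrict l I"]) (auto simp: S_def dual_eq)
qed

end
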